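(* Let $X$ be a $T_1$ topological space and let $\mathbb{P}$ be a basis of $X$ consisting of non-empty open sets, regarded as a poset ordered by inclusion $\subseteq$. Then every cap of $\mathbb{P}$ covers $X$, i.e. if $C\subseteq\mathbb{P}$ is a cap of $\mathbb{P}$ then $\bigcup C=X$.
   Context: Let $(\mathbb{P},\leq)$ be a poset. A subset $S\subseteq\mathbb{P}$ refines $T\subseteq\mathbb{P}$ if for every $s\in S$ there is $t\in T$ with $s\leq t$. A band of $\mathbb{P}$ is a finite subset $B\subseteq\mathbb{P}$ such that every $p\in\mathbb{P}$ is comparable to some $b\in B$ (i.e. $p\leq b$ or $b\leq p$). A cap of $\mathbb{P}$ is a subset $C\subseteq\mathbb{P}$ that is refined by some band of $\mathbb{P}$. *)

theory Defs
  imports "HOL-Analysis.Analysis"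
begin

(* A poset is a set P of elements of an order type, with the induced order.
   On the type 'x set this order is inclusion. *)

definition refines :: "'a::order set \<Rightarrow> 'a set \<Rightarrow> bool" where
  "refines S T \<longleftrightarrow> (\<forall>s\<in>S. \<exists>t\<in>T. s \<le> t)"

definition is_band :: "'a::order set \<Rightarrow> 'a set \<Rightarrow> bool" where
  "is_band P B \<longleftrightarrow> B \<subseteq> P \<and> finite B \<and> (\<forall>p\<in>P. \<exists>b\<in>B. p \<le> b \<or> b \<le> p)"

definition is_cap :: "'a::order set \<Rightarrow> 'a set \<Rightarrow> bool" where
  "is_cap P C \<longleftrightarrow> C \<subseteq> P \<and> (\<exists>B. is_band P B \<and> refines B C)"

definition basis_of :: "'x topology \<Rightarrow> 'x set set \<Rightarrow> bool" where
  "basis_of X P \<longleftrightarrow> openin X = arbitrary union_of (\<lambda>U. U \<in> P)"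

end

theory Submission
  imports Defs
begin

text \<open>
  A band already covers the space, and a cap is refined by a band. To see the former, suppose a
  point \<open>x\<close> lies outside every member of a band. Removing one point from each member of the band
  deletes only finitely many points, all different from \<open>x\<close>; in a \<open>T\<^sub>1\<close> space this leaves an open
  neighbourhood of \<open>x\<close>. A basic neighbourhood of \<open>x\<close> inside it contains no member of the band, since
  it misses a point of each, and is contained in none, since none contains \<open>x\<close>.
  So it is incomparable to the whole band, a contradiction.
\<close>

lemma basis_of_openin:
  assumes "basis_of X P" and "p \<in> P"
  shows "openin X p"
  using assms by (simp add: basis_of_def union_of_inc arbitrary_def)

lemma basis_of_neighbourhood:
  assumes "basis_of X P" and "openin X U" and "x \<in> U"
  obtains p where "p \<in> P" "x \<in> p" "p \<subseteq> U"
proof -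
  have "(arbitrary union_of (\<lambda>U. U \<in> P)) U"
    using assms(1,2) by (simp add: basis_of_def)
  then obtain \<U> where "\<U> \<subseteq> P" "\<Union>\<U> = U"
    by (auto simp: union_of_def)
  with assms(3) that show thesis
    by blast
qed

lemma topspace_subset_Union_band:
  assumes t1: "t1_space X" and basis: "basis_of X P" and nonempty: "{} \<notin> P"
    and band: "is_band P B"
  shows "topspace X \<subseteq> \<Union>B"
proof (rule ccontr)
  assume "\<not> topspace X \<subseteq> \<Union>B"
  then obtain x where x: "x \<in> topspace X" "x \<notin> \<Union>B"
    by blast
  have B: "B \<subseteq> P" "finite B" "\<And>p. p \<in> P \<Longrightarrow> \<exists>b\<in>B. p \<subseteq> b \<or> b \<subseteq> p"
    using band by (auto simp: is_band_def)
  have "\<forall>b\<in>B. \<exists>y. y \<in> b"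
    using B(1) nonempty by (metis all_not_in_conv subsetD)
  then obtain y where y: "\<And>b. b \<in> B \<Longrightarrow> y b \<in> b"
    by metis
  have "y ` B \<subseteq> topspace X"
    using y B(1) basis_of_openin[OF basis] openin_subset by blast
  then have "closedin X (y ` B)"
    using t1 B(2) by (simp add: t1_space_closedin_finite)
  then have "openin X (topspace X - y ` B)"
    by blast
  moreover have "x \<in> topspace X - y ` B"
    using x y by blast
  ultimately obtain p where p: "p \<in> P" "x \<in> p" "p \<subseteq> topspace X - y ` B"
    by (rule basis_of_neighbourhood[OF basis])
  from B(3)[OF p(1)] obtain b where "b \<in> B" "p \<subseteq> b \<or> b \<subseteq> p"
    by blast
  with p x(2) y show False
    by blast
qed

theorem proposition1p7:
  fixes X :: "'x topology" and P C :: "'x set set"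
  assumes "t1_space X"
    and "basis_of X P"
    and "{} \<notin> P"
    and "is_cap P C"
  shows "\<Union>C = topspace X"
proof
  show "\<Union>C \<subseteq> topspace X"
    using assms(4) basis_of_openin[OF assms(2)] openin_subset
    unfolding is_cap_def by blast
  obtain B where "is_band P B" and "refines B C"
    using assms(4) by (auto simp: is_cap_def)
  from \<open>is_band P B\<close> have "topspace X \<subseteq> \<Union>B"
    by (rule topspace_subset_Union_band[OF assms(1-3)])
  also have "\<Union>B \<subseteq> \<Union>C"
    using \<open>refines B C\<close> unfolding refines_def by blast
  finally show "topspace X \<subseteq> \<Union>C" .
qed

end
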